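(* Let $n\ge 1$, let $A=\{A_1,\dots,A_n\}$ be a finite set (source alphabet), and let $f=(f_1,\dots,f_n)$ be a probability vector with $f_i>0$ for all $i$. Let $a>0$ and $b$ be real constants. Consider the probability vectors $p=(p_1,\dots,p_n)$ assigned to $A$ (so $p_i\ge 0$ and $\sum_{i=1}^n p_i=1$) that satisfy the constraint $$-\sum_{i=1}^n p_i\ln(f_i)=\text{constant},$$ where $f$ itself is an achievable state, so that the constant equals $-\sum_{i=1}^n f_i\ln(f_i)$. Then the equilibrium distribution obtained from the target function $aH+b$ under this constraint, where $H(p)=-\sum_{i=1}^n p_i\ln(p_i)$, is $f$ and only $f$; that is, $f$ is the unique maximizer of $aH(p)+b$ over all probability vectors $p$ satisfying $-\sum_{i=1}^n p_i\ln(f_i)=-\sum_{i=1}^n f_i\ln(f_i)$.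
   Context: Conventions: $0\ln 0=0$. $H$ is the normalized Boltzmann-Gibbs (Shannon) entropy. The "equilibrium distribution" for a target function $S$ under given constraints is the probability vector which, according to the Maximal Entropy Principle, maximizes $S(p)$ among all probability vectors $p$ satisfying the constraints (including the natural constraint $\sum_i p_i=1$). "Achievable state" means that $f$ is one of the probability vectors satisfying the constraint. "Constant" means that the left-hand side takes the same value for all admissible $p$. *)

theory Defs
  imports Complex_Main "HOL-Library.FuncSet"
begin

text \<open>
  Probability vectors over a finite alphabet \<open>A\<close> are extensional functions on \<open>A\<close>
  (equal to \<open>undefined\<close> outside \<open>A\<close>), so that equality of functions is equality of the
  vectors indexed by \<open>A\<close>.
\<close>

definition prob_vectors :: "'a set \<Rightarrow> ('a \<Rightarrow> real) set" where
  "prob_vectors A = {p \<in> A \<rightarrow>\<^sub>E {0..}. (\<Sum>x\<in>A. p x) = 1}"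

text \<open>The convention \<open>0 ln 0 = 0\<close> holds automatically, since \<open>0 * y = 0\<close> for every real \<open>y\<close>.\<close>

definition shannon_entropy :: "'a set \<Rightarrow> ('a \<Rightarrow> real) \<Rightarrow> real" where
  "shannon_entropy A p = - (\<Sum>x\<in>A. p x * ln (p x))"

text \<open>
  Maximal Entropy Principle: \<open>C\<close> is the constraint imposed in addition to the natural
  constraint that \<open>p\<close> is a probability vector.
\<close>

definition equilibrium_distribution ::
    "'a set \<Rightarrow> (('a \<Rightarrow> real) \<Rightarrow> real) \<Rightarrow> (('a \<Rightarrow> real) \<Rightarrow> bool) \<Rightarrow> ('a \<Rightarrow> real) \<Rightarrow> bool" where
  "equilibrium_distribution A S C p \<longleftrightarrow>
     is_arg_max S (\<lambda>q. q \<in> prob_vectors A \<and> C q) p"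

end

theory Submission
  imports Defs
begin

text \<open>
  On the constraint set the cross entropy of \<open>p\<close> relative to \<open>f\<close> is the constant \<open>c = H f\<close>,
  and by Gibbs' inequality the entropy of \<open>p \<noteq> f\<close> is strictly below its cross entropy.
\<close>

lemma mult_ln_diff_gt:
  fixes p q :: real
  assumes "p \<ge> 0" "q > 0" "p \<noteq> q"
  shows "p - q < p * ln p - p * ln q"
proof (cases "p = 0")
  case True
  then show ?thesis using assms by simp
next
  case False
  with assms have p: "p > 0" by simp
  \<comment> \<open>The tangent bound ln t \<le> t - 1 is an equality only at t = 1. Taking t =
    \<open>q / p\<close>, which differs from 1, and multiplying by \<open>p\<close> gives the claim;
    dividing by \<open>p\<close> is why \<open>p = 0\<close> is treated apart.\<close>
  have "ln (q / p) \<noteq> q / p - 1"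
    using ln_eq_minus_one[of "q / p"] p assms by auto
  with ln_le_minus_one[of "q / p"] p assms have "ln (q / p) < q / p - 1"
    by simp
  then have "p * ln (q / p) < p * (q / p - 1)"
    using p by (rule mult_strict_left_mono)
  then show ?thesis
    using p assms by (simp add: ln_div algebra_simps)
qed

text \<open>Gibbs' inequality, summed from the termwise bound: the linear parts
  \<open>p x - f x\<close> cancel because both vectors have total mass 1, and a single entry where
  they differ makes the sum strict.\<close>

lemma shannon_entropy_less_cross_entropy:
  assumes "finite A" and p: "p \<in> prob_vectors A" and f: "f \<in> prob_vectors A"
    and pos: "\<forall>x\<in>A. f x > 0" and "p \<noteq> f"
  shows "shannon_entropy A p < - (\<Sum>x\<in>A. p x * ln (f x))"
proof -
  have nonneg: "p x \<ge> 0" if "x \<in> A" for x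
    using p that by (auto simp: prob_vectors_def PiE_iff)
  \<comment> \<open>Both vectors are \<open>undefined\<close> outside \<open>A\<close>, so they must
    differ at a point of \<open>A\<close>.\<close>
  obtain y where y: "y \<in> A" "p y \<noteq> f y"
    using p f \<open>p \<noteq> f\<close> unfolding prob_vectors_def by (blast intro: PiE_ext)
  have strict: "p x - f x < p x * ln (p x) - p x * ln (f x)"
    if "x \<in> A" "p x \<noteq> f x" for x
    using mult_ln_diff_gt nonneg pos that by blast
  have "(\<Sum>x\<in>A. p x - f x) < (\<Sum>x\<in>A. p x * ln (p x) - p x * ln (f x))"
  proof (rule sum_strict_mono_ex1)
    show "\<forall>x\<in>A. p x - f x \<le> p x * ln (p x) - p x * ln (f x)"
    proof
      fix x assume "x \<in> A"
      then show "p x - f x \<le> p x * ln (p x) - p x * ln (f x)"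
        using strict[of x] by (cases "p x = f x") auto
    qed
    show "\<exists>x\<in>A. p x - f x < p x * ln (p x) - p x * ln (f x)"
      using strict y by blast
  qed fact
  moreover have "(\<Sum>x\<in>A. p x - f x) = 0"
    using p f by (simp add: prob_vectors_def sum_subtractf)
  ultimately show ?thesis
    by (simp add: shannon_entropy_def sum_subtractf)
qed

theorem theorem3:
  fixes A :: "'a set" and f :: "'a \<Rightarrow> real" and a b c :: real
  assumes "finite A" and "A \<noteq> {}"
    and "f \<in> prob_vectors A"
    and "\<forall>x\<in>A. f x > 0"
    and "a > 0"
    and "- (\<Sum>x\<in>A. f x * ln (f x)) = c"
  shows "{p. equilibrium_distribution A
               (\<lambda>q. a * shannon_entropy A q + b)
               (\<lambda>q. - (\<Sum>x\<in>A. q x * ln (f x)) = c) p} = {f}"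
proof -
  let ?S = "\<lambda>q. a * shannon_entropy A q + b"
  let ?P = "\<lambda>q. q \<in> prob_vectors A \<and> - (\<Sum>x\<in>A. q x * ln (f x)) = c"
  have f: "?P f"
    using assms by simp
  have less: "?S p < ?S f" if "?P p" "p \<noteq> f" for p
  proof -
    \<comment> \<open>The constraint turns the cross entropy of \<open>p\<close> into
      \<open>c\<close>, which is the entropy of \<open>f\<close>.\<close>
    have "shannon_entropy A p < shannon_entropy A f"
      using shannon_entropy_less_cross_entropy[of A p f] that assms
      by (simp add: shannon_entropy_def)
    then show ?thesis
      using \<open>a > 0\<close> by simp
  qed
  \<comment> \<open>\<open>is_arg_max\<close> only demands that no admissible point does strictly
    better. Uniqueness comes from \<open>less\<close>: \<open>f\<close> itself beats every other
    admissible \<open>p\<close>.\<close>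
  have "is_arg_max ?S ?P p \<longleftrightarrow> p = f" for p
    unfolding is_arg_max_def using f less by (metis less_asym less_irrefl)
  then show ?thesis
    by (simp add: equilibrium_distribution_def)
qed

end
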